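(* Let $\mathbf{S}$ be a categorical skew lattice and let $A \geq B$ be comparable $\mathcal{D}$-classes of $\mathbf{S}$. Then $$\bigcup \mathcal{C}(A,B) \;=\; \bigcup\{\varphi_{a,b} : a\in A,\ b\in B\} \;=\; \geq_{A\times B},$$ where $\varphi_{a,b}$ is the coset bijection between $B\vee a\vee B$ and $A\wedge b\wedge A$, each (partial) bijection is regarded as a set of ordered pairs in $A\times B$, and $\geq_{A\times B} = \{(x,y)\in A\times B : x\geq y\}$ is the restriction of the natural partial order of $\mathbf{S}$ to $A\times B$.
   Context: A skew lattice is an algebra $\mathbf{S}=(S;\wedge,\vee)$ with two associative binary operations satisfying the absorption laws $(y\wedge x)\vee x=x$, $x\wedge(x\vee y)=x$, $(y\vee x)\wedge x=x$, $x\vee(x\wedge y)=x$. (Both operations are then idempotent.) The natural partial order is: $x\geq y$ iff $x\wedge y=y=y\wedge x$ (dually, iff $x\vee y=x=y\vee x$). The natural preorder is: $x\succeq y$ iff $x\vee y\vee x=x$ (dually, iff $y\wedge x\wedge y=y$). Green's relation $\mathcal{D}$ is the equivalence $x\,\mathcal{D}\,y$ iff $x\succeq y$ and $y\succeq x$; equivalently $x\wedge y\wedge x=x$ and $y\wedge x\wedge y=y$. It is a congruence and $\mathbf{S}/\mathcal{D}$ is a lattice. For $\mathcal{D}$-classes $A,B$, $A\geq B$ refers to the order of the lattice $\mathbf{S}/\mathcal{D}$ (that is, $a\succeq b$ for $a\in A$, $b\in B$); $A$ and $B$ are comparable if $A\ge B$ or $B\ge A$. For comparable $\mathcal{D}$-classes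 $A\geq B$, $a\in A$ and $b\in B$: the set $A\wedge b\wedge A=\{a'\wedge b\wedge a' : a'\in A\}\subseteq B$ is a coset of $A$ in $B$ (an $A$-coset in $B$), and $B\vee a\vee B=\{b'\vee a\vee b' : b'\in B\}\subseteq A$ is a coset of $B$ in $A$ (a $B$-coset in $A$). It is known that the $A$-cosets in $B$ partition $B$, the $B$-cosets in $A$ partition $A$, and that there is a bijection $\varphi_{a,b}: B\vee a\vee B\to A\wedge b\wedge A$, called a coset bijection, under which $x\in B\vee a\vee B$ corresponds to $y\in A\wedge b\wedge A$ if and only if $x\geq y$; in fact $\varphi_{a,b}(x)=x\wedge b\wedge x$. Coset bijections are regarded as partial bijections from $A$ to $B$. When $A=B$ the coset bijection is the identity on $A$. A skew lattice is categorical if nonempty composites of coset bijections are coset bijections. It is strictly categorical if, in addition, compositions of coset bijections are never empty. For a strictly categorical skew lattice $\mathbf{S}$, the coset category $\mathcal{C}$ has the $\mathcal{D}$-classes of $\mathbf{S}$ as objects; for $A>B$, $\mathcal{C}(A,B)$ consists of all coset bijections from the $B$-cosets in $A$ to the $A$-cosets in $B$; $\mathcal{C}(A,A)$ consists of the identity bijection on $A$; otherwise $\mathcal{C}(A,B)$ consists of the empty bijection. Composition is the usual composition of partial bijections. If $\mathbf{S}$ is just categorical, the definition is modified by requiring that, for each pair $A\geq B$, $\mathcal{C}(A,B)$ also contains the empty bijection. *)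

theory Defs
  imports Main
begin

locale skew_lattice =
  meet: semigroup meet + join: semigroup join
  for meet :: "'a \<Rightarrow> 'a \<Rightarrow> 'a" (infixl "\<sqinter>" 70)
    and join :: "'a \<Rightarrow> 'a \<Rightarrow> 'a" (infixl "\<squnion>" 65) +
  assumes meet_join_absorb: "(y \<sqinter> x) \<squnion> x = x"
    and absorb_meet_join: "x \<sqinter> (x \<squnion> y) = x"
    and join_meet_absorb: "(y \<squnion> x) \<sqinter> x = x"
    and absorb_join_meet: "x \<squnion> (x \<sqinter> y) = x"
begin

definition natural_ge :: "'a \<Rightarrow> 'a \<Rightarrow> bool"
  where "natural_ge x y \<longleftrightarrow> x \<sqinter> y = y \<and> y = y \<sqinter> x"

definition natural_pre :: "'a \<Rightarrow> 'a \<Rightarrow> bool"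
  where "natural_pre x y \<longleftrightarrow> x \<squnion> y \<squnion> x = x"

definition green_D :: "('a \<times> 'a) set"
  where "green_D = {(x, y). natural_pre x y \<and> natural_pre y x}"

definition D_classes :: "'a set set"
  where "D_classes = UNIV // green_D"

definition class_ge :: "'a set \<Rightarrow> 'a set \<Rightarrow> bool"
  where "class_ge A B \<longleftrightarrow> (\<forall>a\<in>A. \<forall>b\<in>B. natural_pre a b)"

definition lower_coset :: "'a set \<Rightarrow> 'a \<Rightarrow> 'a set"
  where "lower_coset A b = {a' \<sqinter> b \<sqinter> a' | a'. a' \<in> A}"

definition upper_coset :: "'a set \<Rightarrow> 'a \<Rightarrow> 'a set"
  where "upper_coset B a = {b' \<squnion> a \<squnion> b' | b'. b' \<in> B}"

text \<open>
  The coset bijection \<open>\<phi>\<close> from \<open>B \<squnion> a \<squnion> B\<close> to \<open>A \<sqinter> b \<sqinter> A\<close>, as a set of ordered pairs, given by its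
  explicit formula. The class \<open>A\<close> enters only through the range; that the range is \<open>A \<sqinter> b \<sqinter> A\<close>,
  and that related pairs are exactly those in the natural partial order, are the lemmas
  \<open>bij_betw_cosets\<close> and \<open>coset_bij_iff\<close>.
\<close>
definition coset_bij :: "'a set \<Rightarrow> 'a \<Rightarrow> 'a \<Rightarrow> ('a \<times> 'a) set"
  where "coset_bij B a b = {(x, x \<sqinter> b \<sqinter> x) | x. x \<in> upper_coset B a}"

definition coset_bijs :: "'a set \<Rightarrow> 'a set \<Rightarrow> ('a \<times> 'a) set set"
  where "coset_bijs A B = {coset_bij B a b | a b. a \<in> A \<and> b \<in> B}"

definition categorical :: bool
  where "categorical \<longleftrightarrow>
    (\<forall>A\<in>D_classes. \<forall>B\<in>D_classes. \<forall>C\<in>D_classes. class_ge A B \<longrightarrow> class_ge B C \<longrightarrow>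
      (\<forall>\<phi>\<in>coset_bijs A B. \<forall>\<psi>\<in>coset_bijs B C. \<phi> O \<psi> \<noteq> {} \<longrightarrow> \<phi> O \<psi> \<in> coset_bijs A C))"

definition strictly_categorical :: bool
  where "strictly_categorical \<longleftrightarrow> categorical \<and>
    (\<forall>A\<in>D_classes. \<forall>B\<in>D_classes. \<forall>C\<in>D_classes. class_ge A B \<longrightarrow> class_ge B C \<longrightarrow>
      (\<forall>\<phi>\<in>coset_bijs A B. \<forall>\<psi>\<in>coset_bijs B C. \<phi> O \<psi> \<noteq> {}))"

text \<open>
  The hom-sets of the coset category: without the second part of the union this is the version for
  strictly categorical skew lattices; for those that are merely categorical, the empty partial
  bijection is added to every hom-set with \<open>A \<ge> B\<close>.
\<close>
definition coset_hom :: "'a set \<Rightarrow> 'a set \<Rightarrow> ('a \<times> 'a) set set"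
  where "coset_hom A B =
    (if A = B then {Id_on A} else if class_ge A B then coset_bijs A B else {{}}) \<union>
    (if class_ge A B \<and> \<not> strictly_categorical then {{}} else {})"

lemma meet_idem: "x \<sqinter> x = x"
  by (metis absorb_meet_join absorb_join_meet)

lemma join_idem: "x \<squnion> x = x"
  by (metis absorb_meet_join absorb_join_meet)

lemma natural_pre_iff_meet: "natural_pre x y \<longleftrightarrow> y \<sqinter> x \<sqinter> y = y"
  unfolding natural_pre_def
  by (metis absorb_join_meet absorb_meet_join join.assoc join_meet_absorb
      meet.assoc meet_join_absorb)

lemma natural_ge_iff_join: "natural_ge x y \<longleftrightarrow> x \<squnion> y = x \<and> x = y \<squnion> x"
  unfolding natural_ge_def
  by (metis meet_join_absorb absorb_meet_join join_meet_absorb absorb_join_meet)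

lemma natural_pre_refl: "natural_pre x x"
  by (simp add: natural_pre_def join_idem)

lemma natural_pre_trans: "natural_pre x y \<Longrightarrow> natural_pre y z \<Longrightarrow> natural_pre x z"
  unfolding natural_pre_def
  by (metis join.assoc join_idem meet_idem absorb_join_meet absorb_meet_join join_meet_absorb)

lemma equiv_green_D: "equiv UNIV green_D"
  by (rule equivI)
    (auto simp: green_D_def refl_on_def sym_def trans_def intro: natural_pre_refl natural_pre_trans)

lemma left_congruence:
  assumes ab: "a \<sqinter> b = a" and ba: "b \<sqinter> a = b"
  shows "a \<sqinter> x \<sqinter> a = a \<sqinter> x \<sqinter> b"
proof -
  define n where "n = (a \<sqinter> x) \<squnion> b"
  have j: "a \<squnion> b = b" "b \<squnion> a = a"
    by (metis ab ba meet_join_absorb)+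
  have "natural_pre n b"
    unfolding natural_pre_def n_def by (metis join.assoc join_idem)
  moreover have "natural_pre b a"
    by (simp add: natural_pre_def j join_idem)
  ultimately have "a \<sqinter> n \<sqinter> a = a"
    using natural_pre_trans natural_pre_iff_meet by blast
  hence "b \<sqinter> n \<sqinter> a = b"
    by (metis ba meet.assoc)
  moreover have "b \<squnion> n = b"
    unfolding n_def by (metis j(1) join.assoc join_idem absorb_join_meet)
  hence "b \<sqinter> n = n"
    by (metis join_meet_absorb)
  ultimately have "n \<sqinter> a = b"
    by simp
  thus ?thesis
    unfolding n_def by (metis meet.assoc absorb_meet_join)
qed

lemma right_congruence:
  assumes ab: "b \<sqinter> a = a" and ba: "a \<sqinter> b = b"
  shows "a \<sqinter> x \<sqinter> a = b \<sqinter> x \<sqinter> a"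
proof -
  define n where "n = b \<squnion> (x \<sqinter> a)"
  have j: "b \<squnion> a = b" "a \<squnion> b = a"
    by (metis ab ba absorb_join_meet)+
  have "natural_pre n b"
    unfolding natural_pre_def n_def by (metis join.assoc join_idem)
  moreover have "natural_pre b a"
    by (simp add: natural_pre_def j join_idem)
  ultimately have "a \<sqinter> n \<sqinter> a = a"
    using natural_pre_trans natural_pre_iff_meet by blast
  hence "a \<sqinter> n \<sqinter> b = b"
    by (metis ba meet.assoc)
  moreover have "n \<squnion> b = b"
    unfolding n_def by (metis j(1) join.assoc join_idem meet_join_absorb)
  hence "n \<sqinter> b = n"
    by (metis absorb_meet_join)
  ultimately have "a \<sqinter> n = b"
    by (simp add: meet.assoc)
  thus ?thesis
    unfolding n_def by (metis meet.assoc join_meet_absorb)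
qed

lemma meet_regular: "x \<sqinter> y \<sqinter> x \<sqinter> z \<sqinter> x = x \<sqinter> y \<sqinter> z \<sqinter> x"
proof -
  have "(z \<sqinter> x) \<sqinter> (x \<sqinter> y) \<sqinter> (z \<sqinter> x) = (z \<sqinter> x) \<sqinter> (x \<sqinter> y) \<sqinter> (x \<sqinter> z \<sqinter> x)"
    by (rule left_congruence; metis meet.assoc meet_idem)
  hence 1: "x \<sqinter> y \<sqinter> z \<sqinter> x \<sqinter> (x \<sqinter> y \<sqinter> x \<sqinter> z \<sqinter> x) = x \<sqinter> y \<sqinter> z \<sqinter> x"
    by (metis meet.assoc meet_idem)
  have "(x \<sqinter> y) \<sqinter> (z \<sqinter> x) \<sqinter> (x \<sqinter> y) = (x \<sqinter> y \<sqinter> x) \<sqinter> (z \<sqinter> x) \<sqinter> (x \<sqinter> y)"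
    by (rule right_congruence; metis meet.assoc meet_idem)
  hence 2: "x \<sqinter> y \<sqinter> z \<sqinter> x \<sqinter> (x \<sqinter> y \<sqinter> x \<sqinter> z \<sqinter> x) = x \<sqinter> y \<sqinter> x \<sqinter> z \<sqinter> x"
    by (metis meet.assoc meet_idem)
  from 1 2 show ?thesis by simp
qed

lemma coset_bij_unique:
  assumes x: "natural_pre x' x" and x': "natural_pre x x'" and b: "natural_pre x b"
    and ge: "natural_ge x (x' \<sqinter> b \<sqinter> x')"
  shows "x' \<sqinter> b \<sqinter> x' = x \<sqinter> b \<sqinter> x"
proof -
  have h: "x \<sqinter> x' \<sqinter> x = x" "b \<sqinter> x \<sqinter> b = b"
    using x b by (simp_all add: natural_pre_iff_meet)
  have "x' \<sqinter> b \<sqinter> x' = x \<sqinter> x' \<sqinter> b \<sqinter> x' \<sqinter> x"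
    using ge by (metis natural_ge_def meet.assoc)
  also have "\<dots> = (x \<sqinter> x' \<sqinter> x) \<sqinter> b \<sqinter> (x \<sqinter> x' \<sqinter> x)"
    by (metis meet_regular meet.assoc)
  finally show ?thesis by (simp add: h)
qed

lemma upper_coset_subset:
  assumes "A \<in> D_classes" "class_ge A B" "a \<in> A"
  shows "upper_coset B a \<subseteq> A"
proof
  fix x assume "x \<in> upper_coset B a"
  then obtain b' where b': "b' \<in> B" "x = b' \<squnion> a \<squnion> b'"
    by (auto simp: upper_coset_def)
  hence "natural_pre a b'"
    using assms by (auto simp: class_ge_def)
  hence "natural_pre x a \<and> natural_pre a x"
    unfolding b' natural_pre_def by (metis join.assoc join_idem)
  hence "(a, x) \<in> green_D"
    by (simp add: green_D_def)
  with assms(1,3) show "x \<in> A"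
    unfolding D_classes_def using equiv_green_D by (metis in_quotient_imp_closed)
qed

lemma lower_coset_subset:
  assumes "B \<in> D_classes" "class_ge A B" "b \<in> B"
  shows "lower_coset A b \<subseteq> B"
proof
  fix y assume "y \<in> lower_coset A b"
  then obtain a' where a': "a' \<in> A" "y = a' \<sqinter> b \<sqinter> a'"
    by (auto simp: lower_coset_def)
  hence "natural_pre a' b"
    using assms by (auto simp: class_ge_def)
  hence "natural_pre y b \<and> natural_pre b y"
    unfolding a' natural_pre_iff_meet by (metis meet.assoc meet_idem)
  hence "(b, y) \<in> green_D"
    by (simp add: green_D_def)
  with assms(1,3) show "y \<in> B"
    unfolding D_classes_def using equiv_green_D by (metis in_quotient_imp_closed)
qed

lemma D_class_pre: "A \<in> D_classes \<Longrightarrow> x \<in> A \<Longrightarrow> y \<in> A \<Longrightarrow> natural_pre x y"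
  using quotient_eq_iff[OF equiv_green_D, of A A x y]
  by (auto simp: D_classes_def green_D_def)

lemma natural_ge_sandwich: "natural_ge x (x \<sqinter> b \<sqinter> x)"
  unfolding natural_ge_def by (metis meet.assoc meet_idem)

lemma coset_bij_iff:
  assumes "A \<in> D_classes" "B \<in> D_classes" "class_ge A B" "a \<in> A" "b \<in> B"
  shows "(x, y) \<in> coset_bij B a b \<longleftrightarrow>
    x \<in> upper_coset B a \<and> y \<in> lower_coset A b \<and> natural_ge x y"
proof (cases "x \<in> upper_coset B a")
  case True
  hence xA: "x \<in> A"
    using upper_coset_subset assms by blast
  have "y = x \<sqinter> b \<sqinter> x" if "y \<in> lower_coset A b" "natural_ge x y"
  proof -
    from that(1) obtain x' where x': "x' \<in> A" "y = x' \<sqinter> b \<sqinter> x'"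
      by (auto simp: lower_coset_def)
    moreover have "natural_pre x b"
      using assms xA by (auto simp: class_ge_def)
    ultimately show ?thesis
      using coset_bij_unique that(2) D_class_pre[OF assms(1)] xA by blast
  qed
  moreover have "x \<sqinter> b \<sqinter> x \<in> lower_coset A b"
    using xA by (auto simp: lower_coset_def)
  ultimately show ?thesis
    using True natural_ge_sandwich[of x b] by (auto simp: coset_bij_def)
qed (auto simp: coset_bij_def)

lemma bij_betw_cosets:
  assumes "A \<in> D_classes" "B \<in> D_classes" "class_ge A B" "a \<in> A" "b \<in> B"
  shows "bij_betw (\<lambda>x. x \<sqinter> b \<sqinter> x) (upper_coset B a) (lower_coset A b)"
proof -
  interpret dual: skew_lattice join meet
    by unfold_locales (rule meet_join_absorb absorb_meet_join join_meet_absorb absorb_join_meet)+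
  have dual_ge: "dual.natural_ge u v \<longleftrightarrow> natural_ge v u" for u v
    unfolding dual.natural_ge_def natural_ge_iff_join by auto
  have dual_pre: "dual.natural_pre u v \<longleftrightarrow> natural_pre v u" for u v
    unfolding dual.natural_pre_def natural_pre_iff_meet by auto
  have up: "x = y \<squnion> a \<squnion> y" if x: "x \<in> upper_coset B a" and y: "y = x \<sqinter> b \<sqinter> x" for x y
  proof -
    have "y \<in> B"
      using x y upper_coset_subset[OF assms(1,3,4)] lower_coset_subset[OF assms(2,3,5)]
      by (auto simp: lower_coset_def)
    moreover obtain b' where b': "b' \<in> B" "x = b' \<squnion> a \<squnion> b'"
      using x by (auto simp: upper_coset_def)
    moreover have "natural_ge x y"
      using natural_ge_sandwich y by simp
    moreover have "natural_pre a y"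
      using \<open>y \<in> B\<close> assms by (auto simp: class_ge_def)
    ultimately show ?thesis
      using dual.coset_bij_unique[of b' y a] D_class_pre[OF assms(2)]
      by (auto simp: dual_ge dual_pre)
  qed
  show ?thesis
  proof (rule bij_betw_byWitness[where f' = "\<lambda>y. y \<squnion> a \<squnion> y"]; (intro ballI)?)
    show "(\<lambda>x. x \<sqinter> b \<sqinter> x) ` upper_coset B a \<subseteq> lower_coset A b"
      using upper_coset_subset[OF assms(1,3,4)] by (auto simp: lower_coset_def)
    show "(\<lambda>y. y \<squnion> a \<squnion> y) ` lower_coset A b \<subseteq> upper_coset B a"
      using lower_coset_subset[OF assms(2,3,5)] by (auto simp: upper_coset_def)
  next
    fix x assume "x \<in> upper_coset B a"
    thus "(x \<sqinter> b \<sqinter> x) \<squnion> a \<squnion> (x \<sqinter> b \<sqinter> x) = x"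
      using up by simp
  next
    fix y assume y: "y \<in> lower_coset A b"
    hence "y \<squnion> a \<squnion> y \<in> upper_coset B a"
      using lower_coset_subset[OF assms(2,3,5)] by (auto simp: upper_coset_def)
    moreover have "natural_ge (y \<squnion> a \<squnion> y) y"
      using dual.natural_ge_sandwich by (simp add: dual_ge)
    ultimately have "(y \<squnion> a \<squnion> y, y) \<in> coset_bij B a b"
      using y coset_bij_iff[OF assms] by simp
    thus "(y \<squnion> a \<squnion> y) \<sqinter> b \<sqinter> (y \<squnion> a \<squnion> y) = y"
      by (auto simp: coset_bij_def)
  qed
qed

lemma coset_bij_self:
  assumes "A \<in> D_classes" "a \<in> A" "b \<in> A"
  shows "coset_bij A a b = Id_on A"
proof -
  have "x \<sqinter> b \<sqinter> x = x" "x \<squnion> a \<squnion> x = x" if "x \<in> A" for x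
    using D_class_pre[OF assms(1)] that assms(2,3) natural_pre_iff_meet natural_pre_def by blast+
  moreover have "class_ge A A"
    using D_class_pre[OF assms(1)] by (auto simp: class_ge_def)
  hence "upper_coset A a \<subseteq> A"
    using upper_coset_subset assms by blast
  ultimately have "upper_coset A a = A" "\<And>x. x \<in> A \<Longrightarrow> x \<sqinter> b \<sqinter> x = x"
    by (force simp: upper_coset_def)+
  thus ?thesis
    by (auto simp: coset_bij_def Id_on_def)
qed

end

locale categorical_skew_lattice = skew_lattice +
  assumes categorical

end

theory Submission
  imports Defs
begin

text \<open>
  A coset bijection relates only comparable elements, so each \<open>\<phi>\<^sub>a\<^sub>,\<^sub>b\<close> lies inside the natural
  partial order. Conversely, a pair \<open>x \<ge> y\<close> is captured by the coset bijection that it indexes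
  itself: from \<open>x = y \<squnion> x \<squnion> y\<close> and \<open>y = x \<sqinter> y \<sqinter> x\<close> the elements \<open>x\<close> and \<open>y\<close> lie in the cosets
  \<open>B \<squnion> x \<squnion> B\<close> and \<open>A \<sqinter> y \<sqinter> A\<close>, and there \<open>\<phi>\<^sub>x\<^sub>,\<^sub>y\<close> sends \<open>x\<close> to \<open>y\<close>. The hom-set
  \<open>\<C>(A, B)\<close> differs from the family of coset bijections only by the empty bijection, which adds no
  pairs, and in its separate description for \<open>A = B\<close>, where every coset bijection is the identity.
\<close>

context skew_lattice
begin

text \<open>The witness is the bijection indexed by the pair \<open>(x, y)\<close> itself.\<close>

lemma natural_ge_imp_mem_coset_bij:
  assumes "x \<in> A" "y \<in> B" "natural_ge x y"
  shows "(x, y) \<in> coset_bij B x y"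
proof -
  have "y \<squnion> x \<squnion> y = x"
    using assms(3) by (metis natural_ge_iff_join)
  hence "x \<in> upper_coset B x"
    using assms(2) by (force simp: upper_coset_def)
  moreover have "x \<sqinter> y \<sqinter> x = y"
    using assms(3) by (metis natural_ge_def)
  ultimately show ?thesis
    by (force simp: coset_bij_def)
qed

lemma Union_coset_bijs:
  assumes "A \<in> D_classes" "B \<in> D_classes" "class_ge A B"
  shows "\<Union>(coset_bijs A B) = {(x, y) \<in> A \<times> B. natural_ge x y}"
proof (intro equalityI subrelI)
  fix x y assume "(x, y) \<in> \<Union>(coset_bijs A B)"
  then obtain a b where ab: "a \<in> A" "b \<in> B" "(x, y) \<in> coset_bij B a b"
    by (auto simp: coset_bijs_def)
  thus "(x, y) \<in> {(x, y) \<in> A \<times> B. natural_ge x y}"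
    using coset_bij_iff[OF assms ab(1,2)] upper_coset_subset[OF assms(1,3) ab(1)]
      lower_coset_subset[OF assms(2,3) ab(2)]
    by auto
next
  fix x y assume "(x, y) \<in> {(x, y) \<in> A \<times> B. natural_ge x y}"
  hence "x \<in> A" "y \<in> B" "natural_ge x y"
    by auto
  with natural_ge_imp_mem_coset_bij[of x A y B] show "(x, y) \<in> \<Union>(coset_bijs A B)"
    unfolding coset_bijs_def by blast
qed

text \<open>
  A \<open>\<D>\<close>-class is nonempty, so the identity in \<open>\<C>(A, A)\<close> really occurs as a coset bijection.
\<close>

lemma coset_bijs_self:
  assumes "A \<in> D_classes"
  shows "coset_bijs A A = {Id_on A}"
proof -
  have "A \<noteq> {}"
    using assms in_quotient_imp_non_empty[OF equiv_green_D] by (simp add: D_classes_def)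
  thus ?thesis
    using coset_bij_self[OF assms] by (fastforce simp: coset_bijs_def)
qed

lemma Union_coset_hom:
  assumes "A \<in> D_classes" "class_ge A B"
  shows "\<Union>(coset_hom A B) = \<Union>(coset_bijs A B)"
  using assms coset_bijs_self by (auto simp: coset_hom_def)

end

theorem theorem22:
  fixes meet join :: "'a \<Rightarrow> 'a \<Rightarrow> 'a" and A B :: "'a set"
  assumes "categorical_skew_lattice meet join"
    and "A \<in> skew_lattice.D_classes join"
    and "B \<in> skew_lattice.D_classes join"
    and "skew_lattice.class_ge join A B"
  shows "\<Union>(skew_lattice.coset_hom meet join A B)
      = \<Union>{skew_lattice.coset_bij meet join B a b | a b. a \<in> A \<and> b \<in> B}
    \<and> \<Union>{skew_lattice.coset_bij meet join B a b | a b. a \<in> A \<and> b \<in> B}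
      = {(x, y) \<in> A \<times> B. skew_lattice.natural_ge meet x y}"
proof -
  interpret categorical_skew_lattice meet join
    by fact
  show ?thesis
    using Union_coset_hom[OF assms(2,4)] Union_coset_bijs[OF assms(2-4)]
    by (simp add: coset_bijs_def)
qed

end
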